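(* Let $d\ge 2$ and let $\mathcal{A}\in\mathbb{R}^{n_1\times\cdots\times n_d}$ be an arbitrary real tensor. Put $r_k=\min\left(n_{k+1},\prod_{i=k+2}^{d}n_i\right)$ for $k=0,\dots,d-2$. Consider any TTr1 decomposition of $\mathcal{A}$ (as produced by the TTr1SVD procedure described in the context), with leaves $(j_1,\dots,j_{d-1})$, weights $\tilde\sigma_{j_1\cdots j_{d-1}}\ge 0$ and rank-1 tensors $\mathcal{T}_{j_1\cdots j_{d-1}}$. Then $$\mathcal{A}=\sum_{j_1=1}^{r_0}\cdots\sum_{j_{d-1}=1}^{r_{d-2}}\tilde\sigma_{j_1\cdots j_{d-1}}\,\mathcal{T}_{j_1\cdots j_{d-1}},$$ which is a sum of $N=\prod_{k=0}^{d-2}r_k$ terms. Every $\mathcal{T}_{j_1\cdots j_{d-1}}$ has Frobenius norm $1$, and $\langle\mathcal{T}_{j_1\cdots j_{d-1}},\mathcal{T}_{l_1\cdots l_{d-1}}\rangle=0$ whenever $(j_1,\dots,j_{d-1})\ne(l_1,\dots,l_{d-1})$.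
   Context: The inner product of tensors is $\langle\mathcal{A},\mathcal{B}\rangle=\sum_{i_1,\dots,i_d}\mathcal{A}_{i_1\cdots i_d}\mathcal{B}_{i_1\cdots i_d}$, and the Frobenius norm is $\|\mathcal{A}\|_F=\langle\mathcal{A},\mathcal{A}\rangle^{1/2}$. The outer product $a^{(1)}\circ\cdots\circ a^{(d)}$ of vectors is the tensor with entries $a^{(1)}_{i_1}\cdots a^{(d)}_{i_d}$. TTr1SVD procedure. Let $r_k=\min\left(n_{k+1},\prod_{i=k+2}^{d}n_i\right)$ for $0\le k\le d-2$. Level 0: reshape $\mathcal{A}$ into the $n_1\times\prod_{i=2}^d n_i$ matrix $\bar{\mathcal{A}}$ with rows indexed by $i_1$ and columns by $(i_2,\dots,i_d)$. Take an economical SVD $\bar{\mathcal{A}}=\sum_{j=1}^{r_0}\sigma_j u_j v_j^T$, with $\sigma_j\ge0$, $u_1,\dots,u_{r_0}$ orthonormal and $v_1,\dots,v_{r_0}$ orthonormal (zero singular values are allowed and kept). Level $k$, for $1\le k\le d-2$: for each node $(j_1,\dots,j_k)$ with $1\le j_{s+1}\le r_s$, the unit vector $v_{j_1\cdots j_k}$ is indexed by $(i_{k+1},\dots,i_d)$. Reshape it into the $n_{k+1}\times\prod_{i=k+2}^d n_i$ matrix $\bar v_{j_1\cdots j_k}$ with rows indexed by $i_{k+1}$. Take an economical SVD $\bar v_{j_1\cdots j_k}=\sum_{j=1}^{r_k}\sigma_{j_1\cdots j_k j}\,u_{j_1\cdots j_k j}\,v_{j_1\cdots j_k j}^T$, again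 with $\sigma$'s nonnegative and the $u$'s and the $v$'s each orthonormal. The leaves of the resulting tree are the tuples $(j_1,\dots,j_{d-1})$ with $1\le j_{s+1}\le r_s$ for $0\le s\le d-2$. To each leaf are attached the weight $\tilde\sigma_{j_1\cdots j_{d-1}}=\sigma_{j_1}\sigma_{j_1j_2}\cdots\sigma_{j_1\cdots j_{d-1}}$ and the rank-1 tensor $\mathcal{T}_{j_1\cdots j_{d-1}}=u_{j_1}\circ u_{j_1j_2}\circ\cdots\circ u_{j_1\cdots j_{d-1}}\circ v_{j_1\cdots j_{d-1}}$. *)

theory Defs
  imports Complex_Main
begin

text \<open>
  A tensor of format \<open>ns = [n\<^sub>1, \<dots>, n\<^sub>d]\<close> is a function on index tuples, encoded as lists
  of length \<open>d\<close>; only its values on \<open>index_set ns\<close> are relevant.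
  All indices (tensor indices and the labels \<open>j\<close> of the tree) start at 0, so the
  paper's \<open>n\<^bsub>k+1\<^esub>\<close> is \<open>ns ! k\<close>.
\<close>

type_synonym tensor = "nat list \<Rightarrow> real"

definition index_set :: "nat list \<Rightarrow> nat list set" where
  "index_set ns = {ix. length ix = length ns \<and> (\<forall>k < length ns. ix ! k < ns ! k)}"

definition inner_on :: "'i set \<Rightarrow> ('i \<Rightarrow> real) \<Rightarrow> ('i \<Rightarrow> real) \<Rightarrow> real" where
  "inner_on I f g = (\<Sum>x\<in>I. f x * g x)"

definition tensor_inner :: "nat list \<Rightarrow> tensor \<Rightarrow> tensor \<Rightarrow> real" where
  "tensor_inner ns A B = inner_on (index_set ns) A B"

definition frobenius_norm :: "nat list \<Rightarrow> tensor \<Rightarrow> real" where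
  "frobenius_norm ns A = sqrt (tensor_inner ns A A)"

definition outer_product :: "(nat \<Rightarrow> real) list \<Rightarrow> tensor" where
  "outer_product as = (\<lambda>ix. \<Prod>k<length as. (as ! k) (ix ! k))"

definition orthonormal_family :: "nat \<Rightarrow> 'i set \<Rightarrow> (nat \<Rightarrow> 'i \<Rightarrow> real) \<Rightarrow> bool" where
  "orthonormal_family r I u \<longleftrightarrow>
     (\<forall>i<r. \<forall>j<r. inner_on I (u i) (u j) = (if i = j then 1 else 0))"

text \<open>
  SVD with \<open>r\<close> terms of a real matrix with row index set \<open>R\<close> and column index set \<open>C\<close>;
  it is economical when \<open>r\<close> is the minimum of the numbers of rows and columns. Zero singular
  values are allowed and no ordering of the singular values is imposed.
\<close>

definition is_svd :: "nat \<Rightarrow> 'r set \<Rightarrow> 'c set \<Rightarrow> ('r \<Rightarrow> 'c \<Rightarrow> real) \<Rightarrow>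
    (nat \<Rightarrow> real) \<Rightarrow> (nat \<Rightarrow> 'r \<Rightarrow> real) \<Rightarrow> (nat \<Rightarrow> 'c \<Rightarrow> real) \<Rightarrow> bool" where
  "is_svd r R C M \<sigma> u v \<longleftrightarrow>
     (\<forall>x\<in>R. \<forall>y\<in>C. M x y = (\<Sum>j<r. \<sigma> j * u j x * v j y)) \<and>
     (\<forall>j<r. \<sigma> j \<ge> 0) \<and> orthonormal_family r R u \<and> orthonormal_family r C v"

definition reshape :: "tensor \<Rightarrow> nat \<Rightarrow> nat list \<Rightarrow> real" where
  "reshape T = (\<lambda>i ix. T (i # ix))"

definition ttr1_rank :: "nat list \<Rightarrow> nat \<Rightarrow> nat" where
  "ttr1_rank ns k = min (ns ! k) (\<Prod>i\<in>{k+1..<length ns}. ns ! i)"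

definition ttr1_nodes :: "nat list \<Rightarrow> nat \<Rightarrow> nat list set" where
  "ttr1_nodes ns k = {js. length js = k \<and> (\<forall>s<k. js ! s < ttr1_rank ns s)}"

definition ttr1_leaves :: "nat list \<Rightarrow> nat list set" where
  "ttr1_leaves ns = ttr1_nodes ns (length ns - 1)"

text \<open>
  The output of TTr1SVD is recorded by three functions on nodes: \<open>\<sigma> js\<close>, \<open>u js\<close>, \<open>v js\<close> are the
  singular value and the left and right singular vectors attached to a nonempty tuple \<open>js\<close>.
  The root \<open>[]\<close> carries \<open>A\<close> itself, so that level 0 and the levels \<open>1 \<le> k \<le> d - 2\<close> share
  one formula.
\<close>

definition is_TTr1SVD :: "nat list \<Rightarrow> tensor \<Rightarrow>
    (nat list \<Rightarrow> real) \<Rightarrow> (nat list \<Rightarrow> nat \<Rightarrow> real) \<Rightarrow> (nat list \<Rightarrow> tensor) \<Rightarrow> bool" where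
  "is_TTr1SVD ns A \<sigma> u v \<longleftrightarrow>
     (\<forall>k < length ns - 1. \<forall>js \<in> ttr1_nodes ns k.
        is_svd (ttr1_rank ns k) {..<ns ! k} (index_set (drop (k + 1) ns))
          (reshape (if js = [] then A else v js))
          (\<lambda>j. \<sigma> (js @ [j])) (\<lambda>j. u (js @ [j])) (\<lambda>j. v (js @ [j])))"

definition ttr1_weight :: "(nat list \<Rightarrow> real) \<Rightarrow> nat list \<Rightarrow> real" where
  "ttr1_weight \<sigma> js = (\<Prod>s<length js. \<sigma> (take (s + 1) js))"

text \<open>
  At a leaf, \<open>v js\<close> is a tensor of order 1, turned into a vector by \<open>\<lambda>i. v js [i]\<close>.
\<close>

definition ttr1_term ::
    "(nat list \<Rightarrow> nat \<Rightarrow> real) \<Rightarrow> (nat list \<Rightarrow> tensor) \<Rightarrow> nat list \<Rightarrow> tensor" where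
  "ttr1_term u v js =
     outer_product (map (\<lambda>s. u (take (s + 1) js)) [0..<length js] @ [\<lambda>i. v js [i]])"

end

theory Submission
  imports Defs
begin

text \<open>
  Reading the tree one level at a time, every tensor attached to a node of depth \<open>k\<close> is, by its
  singular value decomposition, a combination of left singular vectors in the variable \<open>i\<^bsub>k+1\<^esub>\<close>
  times the tensors attached to its children. Substituting these identities into one another from
  the root downwards expands \<open>A\<close>, at each depth \<open>k\<close>, as a sum over the nodes of that depth
  (\<open>ttr1_expansion\<close>). At depth \<open>d - 1\<close> the remaining factor depends on a single variable,
  and the summands are the weighted rank-1 tensors.

  The inner product of two rank-1 tensors is the product of the inner products of their factors
  (\<open>tensor_inner_outer_product\<close>). Two different leaves have a last common ancestor \<open>p\<close>, and the
  children of \<open>p\<close> through which they pass are different. The left singular vectors at these two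
  children come from the same decomposition, that of the matrix at \<open>p\<close>, hence are
  orthogonal: one factor of the product vanishes. For equal leaves all the factors are squared norms
  of singular vectors, hence equal to 1.
\<close>

section \<open>Sums over index sets\<close>

lemma index_set_Nil: "index_set [] = {[]}"
  by (auto simp: index_set_def)

lemma index_set_snoc:
  "index_set (ns @ [n]) = (\<lambda>(ix, i). ix @ [i]) ` (index_set ns \<times> {..<n})"
proof (intro set_eqI iffI)
  fix x assume x: "x \<in> index_set (ns @ [n])"
  then have len: "length x = Suc (length ns)"
    and lt: "\<And>k. k < Suc (length ns) \<Longrightarrow> x ! k < (ns @ [n]) ! k"
    by (auto simp: index_set_def)
  from len have "x \<noteq> []" by auto
  then obtain y i where xy: "x = y @ [i]" by (metis append_butlast_last_id)
  have "y ! k < ns ! k" if "k < length ns" for k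
    using lt[of k] that len xy by (simp add: nth_append)
  moreover have "i < n"
    using lt[of "length ns"] len xy by (simp add: nth_append)
  ultimately show "x \<in> (\<lambda>(ix, i). ix @ [i]) ` (index_set ns \<times> {..<n})"
    using len xy by (auto simp: index_set_def)
next
  fix x assume "x \<in> (\<lambda>(ix, i). ix @ [i]) ` (index_set ns \<times> {..<n})"
  then show "x \<in> index_set (ns @ [n])"
    by (auto simp: index_set_def nth_append less_Suc_eq)
qed

lemma finite_index_set: "finite (index_set ns)"
  by (induction ns rule: rev_induct) (auto simp: index_set_Nil index_set_snoc)

lemma sum_index_set_snoc:
  fixes f :: "nat list \<Rightarrow> 'a::comm_monoid_add"
  shows "(\<Sum>x\<in>index_set (ns @ [n]). f x) = (\<Sum>ix\<in>index_set ns. \<Sum>i<n. f (ix @ [i]))"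
proof -
  have "inj_on (\<lambda>(ix, i). ix @ [i]) (index_set ns \<times> {..<n})"
    by (auto simp: inj_on_def)
  then show ?thesis
    by (simp add: index_set_snoc sum.reindex sum.cartesian_product o_def case_prod_unfold)
qed

text \<open>
  The distributive law. It makes inner products of outer products factor, and, for constant
  summands 1, it counts the index tuples.
\<close>

lemma sum_index_set_prod:
  fixes f :: "nat \<Rightarrow> nat \<Rightarrow> 'a::comm_semiring_1"
  shows "(\<Sum>ix\<in>index_set ns. \<Prod>k<length ns. f k (ix ! k)) = (\<Prod>k<length ns. \<Sum>i<ns ! k. f k i)"
proof (induction ns rule: rev_induct)
  case Nil
  show ?case by (simp add: index_set_Nil)
next
  case (snoc n ns)
  have "(\<Sum>ix\<in>index_set (ns @ [n]). \<Prod>k<length (ns @ [n]). f k (ix ! k))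
      = (\<Sum>ix\<in>index_set ns. \<Sum>i<n. (\<Prod>k<length ns. f k (ix ! k)) * f (length ns) i)"
    unfolding sum_index_set_snoc
    by (intro sum.cong refl) (auto simp: index_set_def nth_append)
  also have "\<dots> = (\<Prod>k<length ns. \<Sum>i<ns ! k. f k i) * (\<Sum>i<n. f (length ns) i)"
    by (simp add: snoc sum_product flip: sum_distrib_left sum_distrib_right)
  also have "\<dots> = (\<Prod>k<length (ns @ [n]). \<Sum>i<(ns @ [n]) ! k. f k i)"
    by (simp add: nth_append)
  finally show ?case .
qed

lemma card_index_set: "card (index_set ns) = (\<Prod>k<length ns. ns ! k)"
  using sum_index_set_prod[of "\<lambda>_ _. 1::nat" ns] by simp

lemma tensor_inner_outer_product:
  assumes "length as = length ns" "length bs = length ns"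
  shows "tensor_inner ns (outer_product as) (outer_product bs)
    = (\<Prod>k<length ns. inner_on {..<ns ! k} (as ! k) (bs ! k))"
  unfolding tensor_inner_def outer_product_def inner_on_def assms
  using sum_index_set_prod[of "\<lambda>k i. (as ! k) i * (bs ! k) i" ns]
  by (simp add: prod.distrib)

section \<open>The tree of a TTr1 decomposition\<close>

text \<open>
  The nodes of depth \<open>k\<close> are the index tuples of the format \<open>[r\<^sub>0, \<dots>, r\<^bsub>k-1\<^esub>]\<close>, which makes
  the facts on index sets available for sums over the tree.
\<close>

lemma ttr1_nodes_eq_index_set: "ttr1_nodes ns k = index_set (map (ttr1_rank ns) [0..<k])"
  by (auto simp: ttr1_nodes_def index_set_def)

lemma sum_ttr1_nodes_Suc:
  fixes f :: "nat list \<Rightarrow> 'a::comm_monoid_add"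
  shows "(\<Sum>x\<in>ttr1_nodes ns (Suc k). f x)
    = (\<Sum>js\<in>ttr1_nodes ns k. \<Sum>j<ttr1_rank ns k. f (js @ [j]))"
  by (simp add: ttr1_nodes_eq_index_set sum_index_set_snoc)

lemma finite_ttr1_leaves: "finite (ttr1_leaves ns)"
  by (simp add: ttr1_leaves_def ttr1_nodes_eq_index_set finite_index_set)

lemma card_ttr1_nodes: "card (ttr1_nodes ns k) = (\<Prod>s<k. ttr1_rank ns s)"
  by (simp add: ttr1_nodes_eq_index_set card_index_set)

lemma take_in_ttr1_nodes:
  assumes "js \<in> ttr1_nodes ns k" "s \<le> k"
  shows "take s js \<in> ttr1_nodes ns s"
  using assms by (auto simp: ttr1_nodes_def)

lemma ttr1_weight_snoc: "ttr1_weight \<sigma> (js @ [j]) = ttr1_weight \<sigma> js * \<sigma> (js @ [j])"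
  by (simp add: ttr1_weight_def)

lemma is_TTr1SVD_svd:
  assumes "is_TTr1SVD ns A \<sigma> u v" "js \<in> ttr1_nodes ns s" "Suc s < length ns"
  shows "is_svd (ttr1_rank ns s) {..<ns ! s} (index_set (drop (Suc s) ns))
    (reshape (if js = [] then A else v js))
    (\<lambda>j. \<sigma> (js @ [j])) (\<lambda>j. u (js @ [j])) (\<lambda>j. v (js @ [j]))"
  using assms by (auto simp: is_TTr1SVD_def)

lemma ttr1_weight_nonneg:
  assumes svd: "is_TTr1SVD ns A \<sigma> u v" and js: "js \<in> ttr1_nodes ns k" and k: "k < length ns"
  shows "ttr1_weight \<sigma> js \<ge> 0"
  unfolding ttr1_weight_def
proof (rule prod_nonneg)
  fix s assume "s \<in> {..<length js}"
  then have s: "s < k" "s < length js" and jss: "js ! s < ttr1_rank ns s"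
    using js by (auto simp: ttr1_nodes_def)
  have "take s js \<in> ttr1_nodes ns s"
    using js s by (intro take_in_ttr1_nodes) auto
  from is_TTr1SVD_svd[OF svd this] show "0 \<le> \<sigma> (take (s + 1) js)"
    using s k jss by (auto simp: is_svd_def take_Suc_conv_app_nth)
qed

section \<open>Expansion along the levels of the tree\<close>

text \<open>
  Induction on the depth: the SVD at a node of depth \<open>k\<close> peels off the variable of position
  \<open>k\<close> and replaces the tensor at the node by the tensors at its children. Starting from depth 0,
  where the tensor at the root is \<open>A\<close>, lets the first level of the procedure share the
  argument of the others.
\<close>

lemma ttr1_expansion:
  assumes svd: "is_TTr1SVD ns A \<sigma> u v" and ix: "ix \<in> index_set ns" and "k < length ns"
  shows "A ix = (\<Sum>js\<in>ttr1_nodes ns k. ttr1_weight \<sigma> js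
    * ((\<Prod>s<k. u (take (s + 1) js) (ix ! s)) * (if js = [] then A else v js) (drop k ix)))"
  using \<open>k < length ns\<close>
proof (induction k)
  case 0
  show ?case
    by (simp add: ttr1_nodes_eq_index_set index_set_Nil ttr1_weight_def)
next
  case (Suc k)
  have ixk: "ix ! k < ns ! k" "length ix = length ns"
    using ix Suc.prems by (auto simp: index_set_def)
  have ixd: "drop (Suc k) ix \<in> index_set (drop (Suc k) ns)"
    using ix Suc.prems by (auto simp: index_set_def)
  have "ttr1_weight \<sigma> js
      * ((\<Prod>s<k. u (take (s + 1) js) (ix ! s)) * (if js = [] then A else v js) (drop k ix))
    = (\<Sum>j<ttr1_rank ns k. ttr1_weight \<sigma> (js @ [j])
      * ((\<Prod>s<Suc k. u (take (s + 1) (js @ [j])) (ix ! s)) * v (js @ [j]) (drop (Suc k) ix)))"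
    if js: "js \<in> ttr1_nodes ns k" for js
  proof -
    have len: "length js = k" using js by (simp add: ttr1_nodes_def)
    have "(if js = [] then A else v js) (drop k ix)
      = reshape (if js = [] then A else v js) (ix ! k) (drop (Suc k) ix)"
      using ixk Suc.prems by (simp add: reshape_def Cons_nth_drop_Suc)
    also have "\<dots> = (\<Sum>j<ttr1_rank ns k.
        \<sigma> (js @ [j]) * u (js @ [j]) (ix ! k) * v (js @ [j]) (drop (Suc k) ix))"
      using is_TTr1SVD_svd[OF svd js] Suc.prems ixk ixd by (simp add: is_svd_def)
    finally have "(if js = [] then A else v js) (drop k ix) = \<dots>" .
    moreover have "(\<Prod>s<Suc k. u (take (s + 1) (js @ [j])) (ix ! s))
      = (\<Prod>s<k. u (take (s + 1) js) (ix ! s)) * u (js @ [j]) (ix ! k)" for j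
      using len by simp
    ultimately show ?thesis
      unfolding ttr1_weight_snoc by (simp only: sum_distrib_left mult_ac)
  qed
  then show ?case
    using Suc by (simp add: sum_ttr1_nodes_Suc)
qed

section \<open>Orthonormality of the rank-1 terms\<close>

text \<open>
  Left singular vectors of different decompositions need not be orthogonal. The common prefix of
  length \<open>s\<close> ensures that the two vectors belong to children of the same node.
\<close>

lemma inner_on_left_singular_vectors:
  assumes svd: "is_TTr1SVD ns A \<sigma> u v" and "Suc s < length ns" and "s < k"
    and js: "js \<in> ttr1_nodes ns k" and ls: "ls \<in> ttr1_nodes ns k"
    and eq: "take s js = take s ls"
  shows "inner_on {..<ns ! s} (u (take (Suc s) js)) (u (take (Suc s) ls))
    = (if js ! s = ls ! s then 1 else 0)"
proof -
  have "take s ls \<in> ttr1_nodes ns s"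
    using ls \<open>s < k\<close> by (intro take_in_ttr1_nodes) auto
  from is_TTr1SVD_svd[OF svd this \<open>Suc s < length ns\<close>] show ?thesis
    using js ls eq \<open>s < k\<close>
    by (auto simp: is_svd_def orthonormal_family_def ttr1_nodes_def take_Suc_conv_app_nth)
qed

text \<open>
  At a leaf the right singular vector is indexed by tuples of length 1, so its norm as a tensor is
  the norm of the vector that enters the rank-1 term.
\<close>

lemma inner_on_leaf_right_singular_vector:
  assumes svd: "is_TTr1SVD ns A \<sigma> u v" and len: "length ns = Suc (Suc m)"
    and js: "js \<in> ttr1_nodes ns (Suc m)"
  shows "inner_on {..<ns ! Suc m} (\<lambda>i. v js [i]) (\<lambda>i. v js [i]) = 1"
proof -
  have "take m js \<in> ttr1_nodes ns m"
    using js by (intro take_in_ttr1_nodes) auto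
  from is_TTr1SVD_svd[OF svd this] len
  have "inner_on (index_set (drop (Suc m) ns)) (v (take m js @ [js ! m])) (v (take m js @ [js ! m])) = 1"
    using js by (simp add: is_svd_def orthonormal_family_def ttr1_nodes_def)
  moreover have "take m js @ [js ! m] = js"
    using js by (simp add: ttr1_nodes_def flip: take_Suc_conv_app_nth)
  moreover have "drop (Suc m) ns = [] @ [ns ! Suc m]"
    using len by (simp flip: Cons_nth_drop_Suc)
  ultimately show ?thesis
    unfolding inner_on_def by (simp only: sum_index_set_snoc) (simp add: index_set_Nil)
qed

lemma tensor_inner_ttr1_term:
  assumes len: "length ns = Suc m" and js: "length js = m" and ls: "length ls = m"
  shows "tensor_inner ns (ttr1_term u v js) (ttr1_term u v ls)
    = (\<Prod>s<m. inner_on {..<ns ! s} (u (take (Suc s) js)) (u (take (Suc s) ls)))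
      * inner_on {..<ns ! m} (\<lambda>i. v js [i]) (\<lambda>i. v ls [i])"
  unfolding ttr1_term_def
  by (subst tensor_inner_outer_product) (use assms in \<open>simp_all add: nth_append\<close>)

text \<open>
  The position \<open>s\<close> below is the first one at which the two leaves differ; the common prefix of
  length \<open>s\<close> is their last common ancestor.
\<close>

lemma tensor_inner_ttr1_term_distinct:
  assumes svd: "is_TTr1SVD ns A \<sigma> u v" and len: "length ns = Suc m"
    and js: "js \<in> ttr1_nodes ns m" and ls: "ls \<in> ttr1_nodes ns m" and "js \<noteq> ls"
  shows "tensor_inner ns (ttr1_term u v js) (ttr1_term u v ls) = 0"
proof -
  have lens: "length js = m" "length ls = m"
    using js ls by (auto simp: ttr1_nodes_def)
  define s where "s = (LEAST s. js ! s \<noteq> ls ! s)"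
  obtain s' where s': "s' < m" "js ! s' \<noteq> ls ! s'"
    using \<open>js \<noteq> ls\<close> lens by (auto simp: list_eq_iff_nth_eq)
  have s: "js ! s \<noteq> ls ! s"
    unfolding s_def using s'(2) by (rule LeastI)
  have "s \<le> s'"
    unfolding s_def using s'(2) by (rule Least_le)
  then have "s < m" using s'(1) by simp
  have "js ! t = ls ! t" if "t < s" for t
    using not_less_Least that unfolding s_def by blast
  then have "take s js = take s ls"
    using lens \<open>s < m\<close> by (intro nth_equalityI) auto
  then have "inner_on {..<ns ! s} (u (take (Suc s) js)) (u (take (Suc s) ls)) = 0"
    using inner_on_left_singular_vectors[OF svd _ \<open>s < m\<close> js ls] s \<open>s < m\<close> len by simp
  then have "(\<Prod>s<m. inner_on {..<ns ! s} (u (take (Suc s) js)) (u (take (Suc s) ls))) = 0"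
    using \<open>s < m\<close> by (auto intro: prod_zero)
  then show ?thesis
    by (simp add: tensor_inner_ttr1_term[OF len lens])
qed

lemma frobenius_norm_ttr1_term:
  assumes svd: "is_TTr1SVD ns A \<sigma> u v" and len: "length ns = Suc (Suc m)"
    and js: "js \<in> ttr1_nodes ns (Suc m)"
  shows "frobenius_norm ns (ttr1_term u v js) = 1"
proof -
  have lenj: "length js = Suc m" using js by (simp add: ttr1_nodes_def)
  have "(\<Prod>s<Suc m. inner_on {..<ns ! s} (u (take (Suc s) js)) (u (take (Suc s) js))) = 1"
    using inner_on_left_singular_vectors[OF svd _ _ js js] len by (intro prod.neutral) auto
  then show ?thesis
    unfolding frobenius_norm_def tensor_inner_ttr1_term[OF len lenj lenj]
    by (simp only: inner_on_leaf_right_singular_vector[OF svd len js]) simp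
qed

section \<open>The decomposition theorem\<close>

theorem mainTheorem1:
  fixes d :: nat and ns :: "nat list" and A :: tensor
    and \<sigma> :: "nat list \<Rightarrow> real" and u :: "nat list \<Rightarrow> nat \<Rightarrow> real" and v :: "nat list \<Rightarrow> tensor"
  assumes "d \<ge> 2" and "length ns = d"
    and "is_TTr1SVD ns A \<sigma> u v"
  shows "(\<forall>ix \<in> index_set ns.
            A ix = (\<Sum>js \<in> ttr1_leaves ns. ttr1_weight \<sigma> js * ttr1_term u v js ix))
       \<and> finite (ttr1_leaves ns) \<and> card (ttr1_leaves ns) = (\<Prod>k\<in>{0..d - 2}. ttr1_rank ns k)
       \<and> (\<forall>js \<in> ttr1_leaves ns. ttr1_weight \<sigma> js \<ge> 0)
       \<and> (\<forall>js \<in> ttr1_leaves ns. frobenius_norm ns (ttr1_term u v js) = 1)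
       \<and> (\<forall>js \<in> ttr1_leaves ns. \<forall>ls \<in> ttr1_leaves ns. js \<noteq> ls \<longrightarrow>
            tensor_inner ns (ttr1_term u v js) (ttr1_term u v ls) = 0)"
proof -
  obtain m where len: "length ns = Suc (Suc m)" and d: "d = Suc (Suc m)"
    using assms(1,2) by (metis Suc_le_D numeral_2_eq_2 Suc_le_mono)
  have leaves: "ttr1_leaves ns = ttr1_nodes ns (Suc m)"
    by (simp add: ttr1_leaves_def len)
  have "A ix = (\<Sum>js \<in> ttr1_leaves ns. ttr1_weight \<sigma> js * ttr1_term u v js ix)"
    if ix: "ix \<in> index_set ns" for ix
  proof -
    have "drop (Suc m) ix = [ix ! Suc m]"
      using ix len by (simp add: index_set_def flip: Cons_nth_drop_Suc)
    then have "ttr1_term u v js ix = (\<Prod>s<Suc m. u (take (s + 1) js) (ix ! s))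
        * (if js = [] then A else v js) (drop (Suc m) ix)"
      if "js \<in> ttr1_nodes ns (Suc m)" for js
      using that by (auto simp: ttr1_term_def outer_product_def ttr1_nodes_def nth_append)
    then show ?thesis
      using ttr1_expansion[OF assms(3) ix, of "Suc m"] len by (simp add: leaves)
  qed
  moreover have "card (ttr1_leaves ns) = (\<Prod>k\<in>{0..d - 2}. ttr1_rank ns k)"
    by (simp add: leaves card_ttr1_nodes d atLeast0AtMost lessThan_Suc_atMost)
  moreover have "ttr1_weight \<sigma> js \<ge> 0" if "js \<in> ttr1_leaves ns" for js
    using ttr1_weight_nonneg[OF assms(3)] that len by (simp add: leaves)
  ultimately show ?thesis
    using finite_ttr1_leaves[of ns] frobenius_norm_ttr1_term[OF assms(3) len]
      tensor_inner_ttr1_term_distinct[OF assms(3) len]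
    by (simp add: leaves)
qed

end
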